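(* Let $G=(V,E)$ be a connected graph of finite diameter and let $f\colon V\to\mathbb{R}$ be a bounded function. Then there is a constant $c_f\in\mathbb{R}$ such that the following holds: for any bounded function $u_0\colon V\to\mathbb{R}$, if $(u_n)_{n\ge 0}$ is the sequence of game values on $G$ with terminal payoff $u_0$ and running payoff $f$, then the sequence of functions $(u_n-nc_f)_{n\ge 0}$ is (uniformly) bounded, i.e. $\sup_{n}\sup_{x\in V}|u_n(x)-nc_f|<\infty$.
   Context: Graphs may have loops, and may have uncountably many vertices and vertices of infinite degree; every vertex has at least one neighbor. We write $x\sim y$ if $x$ and $y$ are joined by an edge ($x\sim x$ exactly when there is a loop at $x$). The diameter is with respect to the graph metric. Game values: in the tug-of-war game of horizon $n$ with running payoff $f$ and terminal payoff $u_0$ (bounded functions on $V$), a token starts at $x\in V$; at each of $n$ steps Player II pays Player I the amount $f$ at the current position, a fair coin is tossed, and the winner moves the token to a neighbor of its current position; after $n$ steps, if the token is at $y$, Player II pays Player I $u_0(y)$. The value $u_n(x)$ of this game (expected payoff under optimal play) is given by the recursion, starting from $u_0$, $$u_{n+1}(x)=\frac12\Big(\inf_{y\sim x}u_n(y)+\sup_{y\sim x}u_n(y)\Big)+f(x),\qquad x\in V,\ n\ge 0,$$ and $(u_n)_{n\ge0}$ so defined is the sequence of game values. *)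

theory Defs
  imports "HOL-Analysis.Analysis" "Graph_Theory.Graph_Theory"
begin

text \<open>
  A possibly infinite undirected graph without parallel edges, loops allowed, is a symmetric
  digraph without parallel arcs: an edge \<open>x \<sim> y\<close> is the pair of opposite arcs (a loop is a
  single arc), so adjacency is \<open>x \<rightarrow>\<^bsub>G\<^esub> y\<close>. The locale \<open>graph\<close> of the library
  is not applicable, since it requires finiteness and excludes loops.
\<close>

locale tow_graph = sym_digraph G + nomulti_digraph G
  for G :: "('a, 'b) pre_digraph" (structure) +
  assumes has_neighbor: "x \<in> verts G \<Longrightarrow> \<exists>y. x \<rightarrow> y"
begin

definition graph_dist :: "'a \<Rightarrow> 'a \<Rightarrow> ereal"
  where "graph_dist x y = \<mu> (\<lambda>_. 1) x y"

definition graph_diameter :: ereal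
  where "graph_diameter = (SUP x\<in>verts G. SUP y\<in>verts G. graph_dist x y)"

text \<open>
  \<open>game_value f u0 n\<close> is \<open>u\<^sub>n\<close>. The extrema are taken in \<open>real\<close>; they are
  meaningful at \<open>x \<in> verts G\<close> because the neighborhood is nonempty and \<open>u\<^sub>n\<close> is bounded on
  \<open>verts G\<close> whenever \<open>f\<close> and \<open>u0\<close> are. Values outside \<open>verts G\<close> are irrelevant.
\<close>

primrec game_value :: "('a \<Rightarrow> real) \<Rightarrow> ('a \<Rightarrow> real) \<Rightarrow> nat \<Rightarrow> 'a \<Rightarrow> real" where
  "game_value f u0 0 = u0"
| "game_value f u0 (Suc n) = (\<lambda>x.
     1 / 2 * ((INF y\<in>{y. x \<rightarrow> y}. game_value f u0 n y)
            + (SUP y\<in>{y. x \<rightarrow> y}. game_value f u0 n y)) + f x)"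

end

end

theory Submission
  imports Defs
begin

text \<open>
  The recursion step is monotone and commutes with adding constants, hence nonexpansive, so the
  terminal payoff only matters up to a bounded error and one may start from \<open>0\<close>. Then
  consecutive values differ by at most \<open>\<bar>f\<bar>\<close>. A player who always pulls towards a fixed vertex
  \<open>y\<close> reaches it in bounded expected time, as the distance to \<open>y\<close> is dominated by a random walk
  on \<open>{0..D}\<close> reflected at the diameter \<open>D\<close>; this bounds the oscillation of \<open>u\<^sub>n\<close> uniformly in
  \<open>n\<close>. So \<open>n \<mapsto> u\<^sub>n(x\<^sub>0)\<close> is additive up to a bounded error, and therefore linear up to a
  bounded error.
\<close>

section \<open>Sequences additive up to a bounded error\<close>

text \<open>Comparing \<open>k * a n\<close> and \<open>n * a k\<close> through
  \<open>a (k * n)\<close> puts every \<open>(a n - K) / n\<close> below every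
  \<open>(a k + K) / k\<close>; a number separating the two families is the slope.\<close>

lemma quasi_additive_nat_imp_near_linear:
  fixes a :: "nat \<Rightarrow> real"
  assumes quasi: "\<And>m n. \<bar>a (m + n) - a m - a n\<bar> \<le> K"
  shows "\<exists>c. \<forall>n. \<bar>a n - real n * c\<bar> \<le> K"
proof -
  have mult: "\<bar>a (k * n) - real k * a n\<bar> \<le> (real k - 1) * K" if "1 \<le> k" for k n
    using that
  proof (induction k rule: dec_induct)
    case base
    then show ?case by simp
  next
    case (step k)
    have "\<bar>a (n + k * n) - a n - a (k * n)\<bar> \<le> K" by (rule quasi)
    with step.IH show ?case
      by (auto simp: algebra_simps abs_le_iff)
  qed
  have cross: "(a n - K) / real n \<le> (a k + K) / real k" if "1 \<le> n" "1 \<le> k" for n k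
  proof -
    have "\<bar>a (k * n) - real k * a n\<bar> \<le> (real k - 1) * K"
      "\<bar>a (k * n) - real n * a k\<bar> \<le> (real n - 1) * K"
      using mult[of k n] mult[of n k] that by (simp_all add: mult.commute)
    moreover have "0 \<le> K" using quasi[of 0 0] by simp
    ultimately have "real k * (a n - K) \<le> real n * (a k + K)"
      by (auto simp: algebra_simps abs_le_iff)
    then show ?thesis using that by (simp add: field_simps)
  qed
  define c where "c = (SUP n\<in>{1..}. (a n - K) / real n)"
  have "\<bar>a n - real n * c\<bar> \<le> K" for n
  proof (cases "n = 0")
    case True
    then show ?thesis using quasi[of 0 0] by simp
  next
    case False
    have "bdd_above ((\<lambda>n. (a n - K) / real n) ` {1..})"
      using cross[of _ 1] by (intro bdd_aboveI2[where M = "(a 1 + K) / real 1"]) simp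
    then have "(a n - K) / real n \<le> c"
      unfolding c_def using False by (intro cSUP_upper) auto
    moreover have "c \<le> (a n + K) / real n"
      unfolding c_def using False by (intro cSUP_least cross) auto
    ultimately show ?thesis using False by (simp add: field_simps abs_le_iff)
  qed
  then show ?thesis by blast
qed

section \<open>Comparison properties of the recursion\<close>

context tow_graph
begin

lemma neighbor_in_verts: "x \<rightarrow> y \<Longrightarrow> y \<in> verts G"
  by auto

lemma dominates_sym: "x \<rightarrow> y \<Longrightarrow> y \<rightarrow> x"
  using sym_arcs by (auto simp: symmetric_def dest: symD)

lemma bounded_imp_bdd_nbrs:
  fixes u :: "'a \<Rightarrow> real"
  assumes "bounded (u ` verts G)"
  shows "bdd_below (u ` {y. x \<rightarrow> y})" "bdd_above (u ` {y. x \<rightarrow> y})"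
proof -
  have "bounded (u ` {y. x \<rightarrow> y})"
    using assms by (rule bounded_subset) auto
  then show "bdd_below (u ` {y. x \<rightarrow> y})" "bdd_above (u ` {y. x \<rightarrow> y})"
    by (simp_all add: bounded_imp_bdd_below bounded_imp_bdd_above)
qed

text \<open>Keeps the extrema in the recursion genuine. The bound obtained grows with
  \<open>n\<close>; uniform control comes only later.\<close>

lemma bounded_game_value:
  assumes f: "bounded (f ` verts G)" and u: "bounded (u ` verts G)"
  shows "bounded (game_value f u n ` verts G)"
proof (induction n)
  case 0
  then show ?case using u by simp
next
  case (Suc n)
  let ?v = "game_value f u n"
  obtain B where B: "\<And>x. x \<in> verts G \<Longrightarrow> \<bar>?v x\<bar> \<le> B"
    using Suc.IH by (auto simp: bounded_real)
  obtain F where F: "\<And>x. x \<in> verts G \<Longrightarrow> \<bar>f x\<bar> \<le> F"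
    using f by (auto simp: bounded_real)
  have "\<bar>game_value f u (Suc n) x\<bar> \<le> B + F" if x: "x \<in> verts G" for x
  proof -
    note bdd = bounded_imp_bdd_nbrs[OF Suc.IH, of x]
    obtain y where y: "x \<rightarrow> y" using has_neighbor[OF x] by blast
    have nb: "-B \<le> ?v z" "?v z \<le> B" if "x \<rightarrow> z" for z
      using B[OF neighbor_in_verts[OF that]] by auto
    have "-B \<le> (INF z\<in>{z. x \<rightarrow> z}. ?v z)" "(SUP z\<in>{z. x \<rightarrow> z}. ?v z) \<le> B"
      using y nb by (auto intro!: cINF_greatest cSUP_least)
    moreover have "(INF z\<in>{z. x \<rightarrow> z}. ?v z) \<le> ?v y" "?v y \<le> (SUP z\<in>{z. x \<rightarrow> z}. ?v z)"
      using y bdd by (auto intro!: cINF_lower cSUP_upper)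
    moreover have "\<bar>f x\<bar> \<le> F" by (rule F[OF x])
    ultimately show ?thesis
      using nb[OF y] unfolding game_value.simps abs_le_iff by argo
  qed
  then show ?case by (auto simp: bounded_real)
qed

text \<open>Infimum and supremum both preserve a comparison up to a constant, and \<open>f\<close>
  cancels. The sign of \<open>c\<close> is free.\<close>

lemma game_value_mono_add:
  assumes f: "bounded (f ` verts G)"
    and u: "bounded (u ` verts G)" and v: "bounded (v ` verts G)"
    and le: "\<And>x. x \<in> verts G \<Longrightarrow> u x \<le> v x + c"
    and x: "x \<in> verts G"
  shows "game_value f u n x \<le> game_value f v n x + c"
  using x
proof (induction n arbitrary: x)
  case 0
  then show ?case using le by simp
next
  case (Suc n)
  let ?u = "game_value f u n" and ?v = "game_value f v n" and ?N = "{y. x \<rightarrow> y}"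
  note bu = bounded_imp_bdd_nbrs[OF bounded_game_value[OF f u], of n x]
  note bv = bounded_imp_bdd_nbrs[OF bounded_game_value[OF f v], of n x]
  have ne: "?N \<noteq> {}" using has_neighbor[OF Suc.prems] by blast
  have IH: "?u y \<le> ?v y + c" if "y \<in> ?N" for y
    using that by (intro Suc.IH) auto
  have "(INF y\<in>?N. ?u y) - c \<le> (INF y\<in>?N. ?v y)"
  proof (rule cINF_greatest[OF ne])
    fix y assume y: "y \<in> ?N"
    have "(INF y\<in>?N. ?u y) \<le> ?u y" by (rule cINF_lower[OF bu(1) y])
    then show "(INF y\<in>?N. ?u y) - c \<le> ?v y" using IH[OF y] by linarith
  qed
  moreover have "(SUP y\<in>?N. ?u y) \<le> (SUP y\<in>?N. ?v y) + c"
  proof (rule cSUP_least[OF ne])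
    fix y assume y: "y \<in> ?N"
    have "?v y \<le> (SUP y\<in>?N. ?v y)" by (rule cSUP_upper[OF y bv(2)])
    then show "?u y \<le> (SUP y\<in>?N. ?v y) + c" using IH[OF y] by linarith
  qed
  ultimately show ?case unfolding game_value.simps by argo
qed

text \<open>Two comparisons, with constants \<open>b + C\<close> and \<open>C - b\<close>. The
  offset \<open>b\<close> serves for payoffs close to a nonzero constant.\<close>

lemma game_value_nonexpansive:
  assumes f: "bounded (f ` verts G)"
    and u: "bounded (u ` verts G)" and v: "bounded (v ` verts G)"
    and le: "\<And>x. x \<in> verts G \<Longrightarrow> \<bar>u x - v x - b\<bar> \<le> C"
    and x: "x \<in> verts G"
  shows "\<bar>game_value f u n x - game_value f v n x - b\<bar> \<le> C"
proof -
  have "game_value f u n x \<le> game_value f v n x + (b + C)"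
    using le by (intro game_value_mono_add f u v x) (fastforce simp: abs_le_iff)
  moreover have "game_value f v n x \<le> game_value f u n x + (C - b)"
    using le by (intro game_value_mono_add f u v x) (fastforce simp: abs_le_iff)
  ultimately show ?thesis by (auto simp: abs_le_iff)
qed

lemma game_value_add: "game_value f u (m + n) = game_value f (game_value f u m) n"
  by (induction n) simp_all

text \<open>The extra step is played first: it turns the payoff 0 into \<open>f\<close>, which is
  within \<open>F\<close> of 0, and the other \<open>n\<close> steps do not enlarge this
  gap.\<close>

lemma game_value_zero_Suc_diff:
  assumes F: "\<And>x. x \<in> verts G \<Longrightarrow> \<bar>f x\<bar> \<le> F" and x: "x \<in> verts G"
  shows "\<bar>game_value f (\<lambda>_. 0) (Suc n) x - game_value f (\<lambda>_. 0) n x\<bar> \<le> F"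
proof -
  have f: "bounded (f ` verts G)" using F by (auto simp: bounded_real)
  have z: "bounded ((\<lambda>_. 0 :: real) ` verts G)" by (auto simp: bounded_real)
  have "game_value f (\<lambda>_. 0) (Suc 0) y = f y" if "y \<in> verts G" for y
    using has_neighbor[OF that] by (auto simp: image_constant_conv)
  then have "\<bar>game_value f (\<lambda>_. 0) (Suc 0) y - 0 - 0\<bar> \<le> F" if "y \<in> verts G" for y
    using F that by simp
  then have "\<bar>game_value f (game_value f (\<lambda>_. 0) (Suc 0)) n x - game_value f (\<lambda>_. 0) n x - 0\<bar> \<le> F"
    by (intro game_value_nonexpansive f z x bounded_game_value)
  then show ?thesis using game_value_add[of f "\<lambda>_. 0" "Suc 0" n] by simp
qed

section \<open>Walks and the oscillation bound\<close>

lemma finite_diameter_imp_relpow: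
  assumes "graph_diameter < \<infinity>"
  obtains D where "\<And>x y. x \<in> verts G \<Longrightarrow> y \<in> verts G \<Longrightarrow> \<exists>j\<le>D. (x, y) \<in> arcs_ends G ^^ j"
proof -
  have walk: "(x, y) \<in> arcs_ends G ^^ length p \<and> awalk_cost (\<lambda>_. 1) p = real (length p)"
    if "awalk x p y" for x p y
    using that
  proof (induction p arbitrary: x)
    case Nil
    then show ?case by (simp add: awalk_Nil_iff)
  next
    case (Cons e p)
    then have "x \<rightarrow> head G e" "awalk (head G e) p y"
      by (auto simp: awalk_Cons_iff arcs_ends_conv)
    with Cons.IH show ?case by (auto intro: relpow_Suc_I2 simp del: relpow.simps)
  qed
  obtain D :: nat where D: "graph_diameter \<le> ereal (real D)"
  proof (cases graph_diameter)
    case (real r)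
    obtain D :: nat where "r \<le> real D" using real_arch_simple by blast
    then show ?thesis using real that by simp
  \<comment> \<open>Over an empty vertex set the supremum is \<open>-\<infinity>\<close>, and 0
    serves as \<open>D\<close>.\<close>
  qed (use assms that[of 0] in auto)
  have "\<exists>j\<le>D. (x, y) \<in> arcs_ends G ^^ j" if xy: "x \<in> verts G" "y \<in> verts G" for x y
  proof -
    have "graph_dist x y \<le> graph_diameter"
      unfolding graph_diameter_def using xy by (meson SUP_upper2 order_refl)
    \<comment> \<open>A strict bound on the infimum yields a walk below it; costs are integers, so
      cost below \<open>D + 1\<close> means length at most \<open>D\<close>.\<close>
    also have "\<dots> < ereal (real D + 1)" using D by (rule order.strict_trans1) simp
    finally obtain p where p: "awalk x p y" "ereal (awalk_cost (\<lambda>_. 1) p) < ereal (real D + 1)"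
      unfolding graph_dist_def \<mu>_def by (auto simp: INF_less_iff)
    with walk[OF p(1)] have "length p \<le> D" by simp
    with walk[OF p(1)] show ?thesis by blast
  qed
  then show thesis by (rule that)
qed

text \<open>
  The barrier \<open>2F j(2D+1-j)\<close> has second difference \<open>-4F\<close> in \<open>j\<close> and equal values at \<open>D\<close> and
  \<open>D+1\<close>.
\<close>
lemma game_value_zero_lower_bound:
  assumes F: "\<And>x. x \<in> verts G \<Longrightarrow> \<bar>f x\<bar> \<le> F"
    and D: "\<And>x y. x \<in> verts G \<Longrightarrow> y \<in> verts G \<Longrightarrow> \<exists>j\<le>D. (x, y) \<in> arcs_ends G ^^ j"
    and "x \<in> verts G" "y \<in> verts G" "j \<le> D" "(x, y) \<in> arcs_ends G ^^ j"
  shows "game_value f (\<lambda>_. 0) n y - 2 * F * (real j * (2 * real D + 1 - real j))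
    \<le> game_value f (\<lambda>_. 0) n x"
  using assms(3-)
proof (induction n arbitrary: x j)
  case 0
  have "0 \<le> F" using F[OF \<open>x \<in> verts G\<close>] by linarith
  then show ?case using \<open>j \<le> D\<close> by simp
next
  case (Suc n)
  let ?u = "game_value f (\<lambda>_. 0)" and ?N = "{z. x \<rightarrow> z}"
  define \<phi> where "\<phi> j = 2 * F * (real j * (2 * real D + 1 - real j))" for j
  have F0: "0 \<le> F" using F[OF \<open>x \<in> verts G\<close>] by linarith
  have f: "bounded (f ` verts G)" using F by (auto simp: bounded_real)
  have z: "bounded ((\<lambda>_. 0 :: real) ` verts G)" by (auto simp: bounded_real)
  note bdd = bounded_imp_bdd_nbrs[OF bounded_game_value[OF f z], of n x]
  have ne: "?N \<noteq> {}" using has_neighbor[OF \<open>x \<in> verts G\<close>] by blast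
  have \<phi>_Suc: "\<phi> (Suc i) = \<phi> i + 4 * F * (real D - real i)" for i
    unfolding \<phi>_def by (simp add: algebra_simps)
  have \<phi>_mono: "\<phi> i \<le> \<phi> k" if "i \<le> k" "k \<le> D" for i k
    using that(1,2)
  proof (induction k rule: dec_induct)
    case (step k)
    then have "0 \<le> 4 * F * (real D - real k)" using F0 by simp
    with step show ?case by (simp add: \<phi>_Suc)
  qed simp
  show ?case
  proof (cases j)
    case 0
    then show ?thesis using Suc.prems by simp
  next
    case (Suc i)
    \<comment> \<open>Winning the toss: the first arc of the walk shortens it by one.\<close>
    obtain x' where x': "x \<rightarrow> x'" "(x', y) \<in> arcs_ends G ^^ i"
      using Suc.prems(4) unfolding Suc by (meson relpow_Suc_D2)
    have "?u n y - \<phi> i \<le> ?u n x'"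
      unfolding \<phi>_def using x' Suc.prems Suc by (intro Suc.IH) auto
    also have "\<dots> \<le> (SUP z\<in>?N. ?u n z)"
      using x'(1) bdd(2) by (intro cSUP_upper) auto
    finally have sup: "?u n y - \<phi> i \<le> (SUP z\<in>?N. ?u n z)" .
    \<comment> \<open>Losing the toss: from any \<open>z\<close>, going back to \<open>x\<close>
      first gives a walk longer by one.\<close>
    have inf: "?u n y - \<phi> (Suc j) \<le> (INF z\<in>?N. ?u n z)"
    proof (rule cINF_greatest[OF ne])
      fix z assume "z \<in> ?N"
      then have xz: "x \<rightarrow> z" and zv: "z \<in> verts G" by auto
      show "?u n y - \<phi> (Suc j) \<le> ?u n z"
      proof (cases "j < D")
        case True
        have "(z, y) \<in> arcs_ends G ^^ Suc j"
          using dominates_sym[OF xz] Suc.prems(4) by (rule relpow_Suc_I2)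
        then show ?thesis
          unfolding \<phi>_def using True by (intro Suc.IH zv Suc.prems(2)) auto
      next
        \<comment> \<open>Reflection at \<open>D\<close>: length \<open>D + 1\<close> is outside the
          induction hypothesis, so a walk of length \<open>k \<le> D\<close> replaces it, at no loss
          since \<open>\<phi> k \<le> \<phi> D = \<phi> (D + 1)\<close>.\<close>
        case False
        then have "j = D" using Suc.prems(3) by simp
        obtain k where k: "k \<le> D" "(z, y) \<in> arcs_ends G ^^ k"
          using D[OF zv Suc.prems(2)] by blast
        have "?u n y - \<phi> k \<le> ?u n z"
          unfolding \<phi>_def using k by (intro Suc.IH zv Suc.prems(2))
        moreover have "\<phi> k \<le> \<phi> (Suc j)"
          using \<phi>_mono[OF k(1) order_refl] \<open>j = D\<close> by (simp add: \<phi>_Suc)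
        ultimately show ?thesis by linarith
      qed
    qed
    \<comment> \<open>Averaging the two outcomes gains \<open>2 * F\<close>: one \<open>F\<close>
      pays for \<open>f x\<close>, the other for the change of the value at \<open>y\<close> from
      \<open>n\<close> to \<open>Suc n\<close>.\<close>
    have "\<phi> (Suc j) + \<phi> i = 2 * \<phi> j - 4 * F"
      unfolding \<phi>_def Suc by (simp add: algebra_simps)
    moreover have "\<bar>?u (Suc n) y - ?u n y\<bar> \<le> F"
      using F Suc.prems(2) by (rule game_value_zero_Suc_diff)
    moreover have "\<bar>f x\<bar> \<le> F" by (rule F[OF Suc.prems(1)])
    moreover have "?u (Suc n) x = 1 / 2 * ((INF z\<in>?N. ?u n z) + (SUP z\<in>?N. ?u n z)) + f x"
      by simp
    ultimately have "?u (Suc n) y - \<phi> j \<le> ?u (Suc n) x"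
      using sup inf unfolding abs_le_iff by argo
    then show ?thesis unfolding \<phi>_def .
  qed
qed

text \<open>The barrier is bounded for \<open>j \<le> D\<close> independently of \<open>n\<close>;
  exchanging \<open>x\<close> and \<open>y\<close> gives the other direction.\<close>

lemma game_value_zero_oscillation:
  assumes f: "bounded (f ` verts G)" and diam: "graph_diameter < \<infinity>"
  obtains K where "\<And>n x y. x \<in> verts G \<Longrightarrow> y \<in> verts G \<Longrightarrow>
    \<bar>game_value f (\<lambda>_. 0) n x - game_value f (\<lambda>_. 0) n y\<bar> \<le> K"
proof -
  obtain D where D: "\<And>x y. x \<in> verts G \<Longrightarrow> y \<in> verts G \<Longrightarrow> \<exists>j\<le>D. (x, y) \<in> arcs_ends G ^^ j"
    using finite_diameter_imp_relpow[OF diam] by blast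
  obtain F where F: "\<And>x. x \<in> verts G \<Longrightarrow> \<bar>f x\<bar> \<le> F"
    using f by (auto simp: bounded_real)
  define K where "K = 2 * F * (real D * (2 * real D + 1))"
  have *: "game_value f (\<lambda>_. 0) n y - K \<le> game_value f (\<lambda>_. 0) n x"
    if xy: "x \<in> verts G" "y \<in> verts G" for n x y
  proof -
    obtain j where j: "j \<le> D" "(x, y) \<in> arcs_ends G ^^ j" using D[OF xy] by blast
    have "0 \<le> F" using F[OF xy(1)] by linarith
    then have "2 * F * (real j * (2 * real D + 1 - real j)) \<le> K"
      unfolding K_def using j(1) by (intro mult_left_mono mult_mono) auto
    moreover have "game_value f (\<lambda>_. 0) n y - 2 * F * (real j * (2 * real D + 1 - real j))
        \<le> game_value f (\<lambda>_. 0) n x"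
      by (intro game_value_zero_lower_bound F D xy j)
    ultimately show ?thesis by linarith
  qed
  have "\<bar>game_value f (\<lambda>_. 0) n x - game_value f (\<lambda>_. 0) n y\<bar> \<le> K"
    if "x \<in> verts G" "y \<in> verts G" for n x y
    using *[of x y n] *[of y x n] that by linarith
  then show thesis by (rule that)
qed

section \<open>Linear growth of the values\<close>

theorem game_value_near_linear:
  assumes f: "bounded (f ` verts G)" and diam: "graph_diameter < \<infinity>"
  shows "\<exists>c. \<forall>u. bounded (u ` verts G) \<longrightarrow>
    (\<exists>B. \<forall>n. \<forall>x\<in>verts G. \<bar>game_value f u n x - real n * c\<bar> \<le> B)"
proof (cases "verts G = {}")
  case False
  then obtain x0 where x0: "x0 \<in> verts G" by blast
  let ?w = "game_value f (\<lambda>_. 0)"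
  have z: "bounded ((\<lambda>_. 0 :: real) ` verts G)" by (auto simp: bounded_real)
  obtain K where K: "\<And>n x y. x \<in> verts G \<Longrightarrow> y \<in> verts G \<Longrightarrow> \<bar>?w n x - ?w n y\<bar> \<le> K"
    using game_value_zero_oscillation[OF f diam] by blast
  \<comment> \<open>The last \<open>n\<close> steps start from \<open>?w m\<close>, which is within
    \<open>K\<close> of the constant \<open>?w m x0\<close>; this constant is the offset
    \<open>b\<close>.\<close>
  have "\<bar>?w (m + n) x0 - ?w m x0 - ?w n x0\<bar> \<le> K" for m n
  proof -
    have "\<bar>game_value f (?w m) n x0 - ?w n x0 - ?w m x0\<bar> \<le> K"
      using K x0 by (intro game_value_nonexpansive f z bounded_game_value) auto
    then show ?thesis by (simp add: game_value_add algebra_simps)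
  qed
  then obtain c where c: "\<And>n. \<bar>?w n x0 - real n * c\<bar> \<le> K"
    using quasi_additive_nat_imp_near_linear[of "\<lambda>n. ?w n x0"] by blast
  have "\<exists>B. \<forall>n. \<forall>x\<in>verts G. \<bar>game_value f u n x - real n * c\<bar> \<le> B"
    if u: "bounded (u ` verts G)" for u
  proof -
    obtain C where C: "\<And>x. x \<in> verts G \<Longrightarrow> \<bar>u x\<bar> \<le> C"
      using u by (auto simp: bounded_real)
    \<comment> \<open>\<open>C\<close> pays for replacing \<open>u\<close> by 0, one
      \<open>K\<close> for moving from \<open>x\<close> to \<open>x0\<close>, the other for the
      deviation from linearity. As \<open>c\<close> comes from the payoff 0, it does not depend on
      \<open>u\<close>.\<close>
    have "\<bar>game_value f u n x - real n * c\<bar> \<le> C + K + K" if x: "x \<in> verts G" for n x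
    proof -
      have "\<bar>game_value f u n x - ?w n x - 0\<bar> \<le> C"
        using C by (intro game_value_nonexpansive f u z x) auto
      with K[OF x x0, of n] c[of n] show ?thesis by linarith
    qed
    then show ?thesis by blast
  qed
  then show ?thesis by blast
qed simp

end

theorem theorem1p6:
  fixes G :: "('a, 'b) pre_digraph" and f :: "'a \<Rightarrow> real"
  assumes "tow_graph G"
    and "Digraph_Component.connected G"
    and "tow_graph.graph_diameter G < \<infinity>"
    and "bounded (f ` verts G)"
  shows "\<exists>c::real. \<forall>u0 :: 'a \<Rightarrow> real. bounded (u0 ` verts G) \<longrightarrow>
    (SUP n::nat. SUP x\<in>verts G. ereal \<bar>tow_graph.game_value G f u0 n x - real n * c\<bar>) < \<infinity>"
proof -
  interpret tow_graph G by fact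
  obtain c where c: "\<And>u. bounded (u ` verts G) \<Longrightarrow>
      \<exists>B. \<forall>n. \<forall>x\<in>verts G. \<bar>game_value f u n x - real n * c\<bar> \<le> B"
    using game_value_near_linear[OF assms(4,3)] by blast
  have "(SUP n. SUP x\<in>verts G. ereal \<bar>game_value f u0 n x - real n * c\<bar>) < \<infinity>"
    if u0: "bounded (u0 ` verts G)" for u0
  proof -
    obtain B where "\<forall>n. \<forall>x\<in>verts G. \<bar>game_value f u0 n x - real n * c\<bar> \<le> B"
      using c[OF u0] by blast
    then have "(SUP n. SUP x\<in>verts G. ereal \<bar>game_value f u0 n x - real n * c\<bar>) \<le> ereal B"
      by (intro SUP_least) auto
    also have "\<dots> < \<infinity>" by simp
    finally show ?thesis .
  qed
  then show ?thesis by blast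
qed

end
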